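(* Let $S$ be a Boolean inverse semigroup and let $n$ be a positive integer. The following are equivalent: (i) $\operatorname{typ}_S(e)$ has index at most $n$ in $\operatorname{Typ}S$, for every $e\in\operatorname{Idp}S$; (ii) $\mathbf d(x^n)=\mathbf r(x^n)$ for every $x\in S$.
   Context: A semigroup $S$ is inverse if every $x\in S$ has a unique $x^{-1}$ with $x=xx^{-1}x$ and $x^{-1}=x^{-1}xx^{-1}$. Put $\mathbf d(x)=x^{-1}x$, $\mathbf r(x)=xx^{-1}$; $\operatorname{Idp}S$ is the set of idempotents; the natural ordering is $x\le y$ iff $x=y\,\mathbf d(x)$. In an inverse semigroup with zero, $x,y$ are orthogonal if $x^{-1}y=xy^{-1}=0$. A Boolean inverse semigroup is an inverse semigroup $S$ with zero such that $\operatorname{Idp}S$ is a generalized Boolean algebra and any two orthogonal $x,y$ have a join $x\oplus y$ for the natural ordering. Type monoid: $\mathscr D=\mathscr L\circ\mathscr R$, where $x\mathscr L y$ iff $\mathbf d(x)=\mathbf d(y)$ and $x\mathscr R y$ iff $\mathbf r(x)=\mathbf r(y)$. $\operatorname{Int}S$ is the set of $\mathscr D$-classes $\operatorname{typ}_S(x)=x/\mathscr D$ with the partial addition $\operatorname{typ}_S(x)+\operatorname{typ}_S(y)=\operatorname{typ}_S(x\oplus y)$ for orthogonal $x,y$; $\operatorname{Typ}S$ is its universal (commutative) monoid. In a conical commutative monoid $M$ ($x+y=0$ implies $x=y=0$), write $x\le^+y$ if $x+z=y$ for some $z\in M$. The index of $e\in M$ is the least nonnegative integer $n$, if it exists, such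 that $(n+1)x\le^+e$ implies $x=0$ for all $x\in M$, and $\infty$ otherwise. *)

theory Defs
  imports
    "HOL-Algebra.Lattice"
    "HOL-Library.Multiset"
    "HOL-Library.Extended_Nat"
begin

class inverse_semigroup = semigroup_mult +
  assumes ex1_inverse: "\<exists>!y. x = x * y * x \<and> y = y * x * y"
begin

definition sinv :: "'a \<Rightarrow> 'a"
  where "sinv x = (THE y. x = x * y * x \<and> y = y * x * y)"

definition sdom :: "'a \<Rightarrow> 'a"
  where "sdom x = sinv x * x"

definition srng :: "'a \<Rightarrow> 'a"
  where "srng x = x * sinv x"

definition Idp :: "'a set"
  where "Idp = {e. e * e = e}"

definition nat_le :: "'a \<Rightarrow> 'a \<Rightarrow> bool"
  where "nat_le x y \<longleftrightarrow> x = y * sdom x"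

text \<open>Least upper bound in all of \<open>S\<close>, for the natural ordering.\<close>

definition is_join :: "'a \<Rightarrow> 'a \<Rightarrow> 'a \<Rightarrow> bool"
  where "is_join x y z \<longleftrightarrow>
    nat_le x z \<and> nat_le y z \<and> (\<forall>w. nat_le x w \<and> nat_le y w \<longrightarrow> nat_le z w)"

definition greenL :: "'a \<Rightarrow> 'a \<Rightarrow> bool"
  where "greenL x y \<longleftrightarrow> sdom x = sdom y"

definition greenR :: "'a \<Rightarrow> 'a \<Rightarrow> bool"
  where "greenR x y \<longleftrightarrow> srng x = srng y"

definition greenD :: "'a \<Rightarrow> 'a \<Rightarrow> bool"
  where "greenD = greenL OO greenR"

text \<open>There is no unit, so only positive exponents are meaningful; the value at exponent
  \<open>0\<close> is junk (it is \<open>x\<close>).\<close>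

definition spow :: "'a \<Rightarrow> nat \<Rightarrow> 'a"
  where "spow x n = ((\<lambda>y. y * x) ^^ (n - 1)) x"

lemma sinv: "x * sinv x * x = x" "sinv x * x * sinv x = sinv x"
proof -
  have "x = x * sinv x * x \<and> sinv x = sinv x * x * sinv x"
    unfolding sinv_def by (rule theI'[OF ex1_inverse])
  thus "x * sinv x * x = x" "sinv x * x * sinv x = sinv x" by metis+
qed

lemma sinv_unique: "\<lbrakk>x * y * x = x; y * x * y = y\<rbrakk> \<Longrightarrow> sinv x = y"
  using ex1_inverse[of x] sinv[of x] by (metis (full_types))

lemma sinv_idem: "e * e = e \<Longrightarrow> sinv e = e"
  by (rule sinv_unique) simp_all

lemma sinv': "x * (sinv x * x) = x" "x * (sinv x * (x * y)) = x * y"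
    "sinv x * (x * sinv x) = sinv x" "sinv x * (x * (sinv x * y)) = sinv x * y"
  using sinv[of x] by (metis mult.assoc)+

lemma idem_mult:
  assumes "e * e = e" "f * f = f"
  shows "(e * f) * (e * f) = e * f"
proof -
  have e: "e * (e * z) = e * z" for z using assms(1) by (metis mult.assoc)
  have f: "f * (f * z) = f * z" for z using assms(2) by (metis mult.assoc)
  define s where "s = sinv (e * f)"
  have s1: "e * (f * (s * (e * f))) = e * f"
    using sinv(1)[of "e * f"] by (simp add: s_def mult.assoc)
  have s2: "s * (e * (f * s)) = s"
    using sinv(2)[of "e * f"] by (simp add: s_def mult.assoc)
  have s2': "s * (e * (f * (s * z))) = s * z" for z
    using s2 by (metis mult.assoc)
  have "sinv (e * f) = f * (s * e)"
    by (rule sinv_unique) (simp_all add: mult.assoc e f s1 s2')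
  hence s: "f * (s * e) = s" by (simp add: s_def)
  have "f * (s * e) * (f * (s * e)) = f * (s * e)"
    by (simp add: mult.assoc s2')
  hence "s * s = s" by (simp only: s)
  hence "sinv s = s" by (rule sinv_idem)
  moreover have "sinv s = e * f"
    by (rule sinv_unique) (simp_all add: mult.assoc s1 s2)
  ultimately show ?thesis using \<open>s * s = s\<close> by simp
qed

lemma idem_commute:
  assumes "e * e = e" "f * f = f"
  shows "e * f = f * e"
proof -
  have ee: "e * (e * z) = e * z" for z using assms(1) by (metis mult.assoc)
  have ff: "f * (f * z) = f * z" for z using assms(2) by (metis mult.assoc)
  have "sinv (e * f) = f * e"
    using idem_mult[OF assms] idem_mult[OF assms(2,1)]
    by (intro sinv_unique) (simp_all add: mult.assoc ee ff)
  moreover have "sinv (e * f) = e * f"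
    by (rule sinv_idem) (rule idem_mult[OF assms])
  ultimately show ?thesis by simp
qed

lemma sdom_idem: "sdom x * sdom x = sdom x"
  by (simp add: sdom_def mult.assoc sinv')

lemma nat_le_antisym:
  assumes "nat_le x y" "nat_le y x"
  shows "x = y"
proof -
  have x: "x = y * sdom x" and y: "y = x * sdom y"
    using assms by (simp_all add: nat_le_def)
  have yy: "y * sdom y = y" by (simp add: sdom_def sinv')
  have "y = y * sdom x * sdom y" using x y by metis
  also have "\<dots> = y * (sdom y * sdom x)"
    using idem_commute[OF sdom_idem sdom_idem] by (simp add: mult.assoc)
  also have "\<dots> = y * sdom x" by (simp add: mult.assoc[symmetric] yy)
  finally show ?thesis using x by simp
qed

lemma is_join_unique: "is_join x y z \<Longrightarrow> is_join x y w \<Longrightarrow> z = w"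
  unfolding is_join_def by (blast intro: nat_le_antisym)

lemma equivp_greenD: "equivp greenD"
proof (rule equivpI)
  show "reflp greenD"
    by (auto simp: reflp_def greenD_def greenL_def greenR_def)
next
  show "symp greenD"
  proof (rule sympI)
    fix x y assume "greenD x y"
    then obtain z where L: "sinv x * x = sinv z * z" and R: "z * sinv z = y * sinv y"
      by (auto simp: greenD_def greenL_def greenR_def sdom_def srng_def)
    have L': "sinv x * (x * t) = sinv z * (z * t)" for t using L by (metis mult.assoc)
    have R': "z * (sinv z * t) = y * (sinv y * t)" for t using R by (metis mult.assoc)
    define w where "w = x * (sinv z * y)"
    define w' where "w' = sinv y * (z * sinv x)"
    have 1: "w * w' = x * sinv x"
    proof -
      have "w * w' = x * (sinv z * (z * (sinv z * (z * sinv x))))"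
        by (simp add: w_def w'_def mult.assoc R')
      also have "\<dots> = x * (sinv x * (x * sinv x))" by (simp add: sinv' L'[symmetric])
      finally show ?thesis by (simp add: sinv')
    qed
    have 2: "w' * w = sinv y * y"
    proof -
      have "w' * w = sinv y * (z * (sinv z * (z * (sinv z * y))))"
        by (simp add: w_def w'_def mult.assoc L')
      also have "\<dots> = sinv y * y" by (simp add: sinv' R')
      finally show ?thesis .
    qed
    have "sinv w = w'"
      by (rule sinv_unique) (simp_all add: 1 2, simp_all add: w_def w'_def mult.assoc sinv')
    hence "greenL y w" "greenR w x"
      using 1 2 by (auto simp: greenL_def greenR_def sdom_def srng_def)
    thus "greenD y x" by (auto simp: greenD_def)
  qed
next
  show "transp greenD"
  proof (rule transpI)
    fix x y z assume "greenD x y" "greenD y z"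
    then obtain a b where A: "sinv x * x = sinv a * a" "a * sinv a = y * sinv y"
      and B: "sinv y * y = sinv b * b" "b * sinv b = z * sinv z"
      by (auto simp: greenD_def greenL_def greenR_def sdom_def srng_def)
    have A': "a * (sinv a * t) = y * (sinv y * t)" for t using A(2) by (metis mult.assoc)
    have B': "sinv b * (b * t) = sinv y * (y * t)" for t using B(1) by (metis mult.assoc)
    define c where "c = b * (sinv y * a)"
    define c' where "c' = sinv a * (y * sinv b)"
    have 1: "c' * c = sinv a * a"
    proof -
      have "c' * c = sinv a * (y * (sinv y * a))"
        by (simp add: c_def c'_def mult.assoc B' sinv')
      also have "\<dots> = sinv a * a" by (simp add: A'[symmetric] sinv')
      finally show ?thesis .
    qed
    have 2: "c * c' = b * sinv b"
    proof -
      have "c * c' = b * (sinv y * (y * sinv b))"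
        by (simp add: c_def c'_def mult.assoc A' sinv')
      also have "\<dots> = b * sinv b" by (simp add: B'[symmetric] sinv')
      finally show ?thesis .
    qed
    have "sinv c = c'"
      by (rule sinv_unique) (simp_all add: 1 2, simp_all add: c_def c'_def mult.assoc sinv')
    hence "greenL x c" "greenR c z"
      using 1 2 A B by (auto simp: greenL_def greenR_def sdom_def srng_def)
    thus "greenD x z" by (auto simp: greenD_def)
  qed
qed

end

locale generalized_boolean_algebra = lattice L + weak_partial_order_bottom L
  for L (structure) +
  assumes distrib: "\<lbrakk>x \<in> carrier L; y \<in> carrier L; z \<in> carrier L\<rbrakk>
      \<Longrightarrow> x \<sqinter> (y \<squnion> z) = (x \<sqinter> y) \<squnion> (x \<sqinter> z)"
    and rel_compl: "\<lbrakk>x \<in> carrier L; y \<in> carrier L; x \<sqsubseteq> y\<rbrakk>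
      \<Longrightarrow> \<exists>z\<in>carrier L. x \<sqinter> z = \<bottom> \<and> x \<squnion> z = y"

class inverse_semigroup_zero = inverse_semigroup + mult_zero
begin

definition orthogonal :: "'a \<Rightarrow> 'a \<Rightarrow> bool"
  where "orthogonal x y \<longleftrightarrow> sinv x * y = 0 \<and> x * sinv y = 0"

end

class boolean_inverse_semigroup = inverse_semigroup_zero +
  assumes gba_Idp: "generalized_boolean_algebra \<lparr>carrier = Idp, eq = (=), le = nat_le\<rparr>"
    and orthogonal_join: "orthogonal x y \<Longrightarrow> \<exists>z. is_join x y z"
begin

definition oplus :: "'a \<Rightarrow> 'a \<Rightarrow> 'a"
  where "oplus x y = (THE z. is_join x y z)"

lemma is_join_oplus: "orthogonal x y \<Longrightarrow> is_join x y (oplus x y)"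
  unfolding oplus_def
  by (rule theI') (use orthogonal_join is_join_unique in blast)

lemma oplus_eq_0_iff:
  assumes "orthogonal x y"
  shows "oplus x y = 0 \<longleftrightarrow> x = 0 \<and> y = 0"
proof
  assume "oplus x y = 0"
  with is_join_oplus[OF assms] have "nat_le x 0" "nat_le y 0"
    by (simp_all add: is_join_def)
  thus "x = 0 \<and> y = 0" by (simp add: nat_le_def)
next
  assume "x = 0 \<and> y = 0"
  with is_join_oplus[OF assms] have *: "is_join 0 0 (oplus x y)" by simp
  have "nat_le 0 0" by (simp add: nat_le_def sdom_def)
  with * have "nat_le (oplus x y) 0" by (simp add: is_join_def)
  thus "oplus x y = 0" by (simp add: nat_le_def)
qed

lemma greenD_0: "greenD x 0 \<longleftrightarrow> x = 0"
proof
  assume "greenD x 0"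
  then obtain z where "sinv x * x = sinv z * z" "z * sinv z = 0"
    by (auto simp: greenD_def greenL_def greenR_def sdom_def srng_def)
  thus "x = 0" by (metis sinv mult.assoc mult_zero_left mult_zero_right)
qed (simp add: equivp_reflp[OF equivp_greenD])

end

text \<open>\<open>'a dclass\<close> is the underlying set of \<open>Int S\<close>, for \<open>S\<close> the whole type \<open>'a\<close>.\<close>

quotient_type (overloaded) 'a dclass = "'a::boolean_inverse_semigroup" / greenD
  by (rule equivp_greenD)

lift_definition dcl :: "'a::boolean_inverse_semigroup \<Rightarrow> 'a dclass" is "\<lambda>x. x" .

text \<open>The graph of the partial addition of \<open>Int S\<close>: \<open>int_sum a b c\<close> means that \<open>a + b\<close> is
  defined and equal to \<open>c\<close>.\<close>

inductive int_sum ::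
  "'a::boolean_inverse_semigroup dclass \<Rightarrow> 'a dclass \<Rightarrow> 'a dclass \<Rightarrow> bool"
  where "orthogonal x y \<Longrightarrow> int_sum (dcl x) (dcl y) (dcl (oplus x y))"

text \<open>The universal monoid of the partial commutative monoid \<open>Int S\<close> is the quotient of the free
  commutative monoid on the set \<open>Int S\<close> (finite multisets) by the monoid congruence generated by
  the sums that are defined in \<open>Int S\<close> and by identifying the zero of \<open>Int S\<close> with the empty sum.\<close>

inductive typ_cong ::
  "'a::boolean_inverse_semigroup dclass multiset \<Rightarrow> 'a dclass multiset \<Rightarrow> bool"
  where
    typ_cong_zero: "typ_cong {#dcl 0#} {#}"
  | typ_cong_sum: "int_sum a b c \<Longrightarrow> typ_cong {#a, b#} {#c#}"
  | typ_cong_refl: "typ_cong A A"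
  | typ_cong_sym: "typ_cong A B \<Longrightarrow> typ_cong B A"
  | typ_cong_trans: "typ_cong A B \<Longrightarrow> typ_cong B C \<Longrightarrow> typ_cong A C"
  | typ_cong_add: "typ_cong A B \<Longrightarrow> typ_cong C D \<Longrightarrow> typ_cong (A + C) (B + D)"

quotient_type (overloaded) 'a type_monoid =
    "'a::boolean_inverse_semigroup dclass multiset" / typ_cong
  by (rule equivpI)
     (auto simp: reflp_def symp_def transp_def
       intro: typ_cong_refl typ_cong_sym typ_cong_trans)

lift_definition typS :: "'a::boolean_inverse_semigroup \<Rightarrow> 'a type_monoid"
  is "\<lambda>x. {#dcl x#}" .

class conical_comm_monoid_add = comm_monoid_add +
  assumes conical: "x + y = 0 \<Longrightarrow> x = 0 \<and> y = 0"

lemma dcl_eq_0_iff: "dcl x = dcl 0 \<longleftrightarrow> x = 0"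
  by transfer (rule greenD_0)

lemma typ_cong_null:
  "typ_cong A B \<Longrightarrow> (\<forall>a\<in>#A. a = dcl 0) \<longleftrightarrow> (\<forall>b\<in>#B. b = dcl 0)"
proof (induction rule: typ_cong.induct)
  case (typ_cong_sum a b c)
  then show ?case
    by (cases rule: int_sum.cases) (simp add: dcl_eq_0_iff oplus_eq_0_iff)
next
  case (typ_cong_add A B C D)
  have "(\<forall>a\<in>#A + C. a = dcl 0) \<longleftrightarrow> (\<forall>a\<in>#A. a = dcl 0) \<and> (\<forall>a\<in>#C. a = dcl 0)"
    by auto
  moreover have "(\<forall>a\<in>#B + D. a = dcl 0) \<longleftrightarrow> (\<forall>a\<in>#B. a = dcl 0) \<and> (\<forall>a\<in>#D. a = dcl 0)"
    by auto
  ultimately show ?case using typ_cong_add.IH by simp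
qed simp_all

lemma typ_cong_empty:
  assumes "\<forall>a\<in>#A. a = dcl 0"
  shows "typ_cong A {#}"
  using assms
proof (induction A)
  case (add a A)
  hence "typ_cong ({#dcl 0#} + A) ({#} + {#})"
    by (intro typ_cong_add typ_cong_zero) auto
  thus ?case using add.prems by simp
qed (rule typ_cong_refl)

instantiation type_monoid :: (boolean_inverse_semigroup) conical_comm_monoid_add
begin

lift_definition zero_type_monoid :: "'a type_monoid" is "{#}" .

lift_definition plus_type_monoid :: "'a type_monoid \<Rightarrow> 'a type_monoid \<Rightarrow> 'a type_monoid"
  is "(+)" by (rule typ_cong_add)

instance
proof
  fix a b c :: "'a type_monoid"
  show "a + b + c = a + (b + c)"
    by transfer (simp add: add.assoc typ_cong_refl)
  show "a + b = b + a"
    by transfer (simp add: add.commute typ_cong_refl)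
  show "0 + a = a"
    by transfer (simp add: typ_cong_refl)
  show "a + b = 0 \<Longrightarrow> a = 0 \<and> b = 0"
  proof transfer
    fix A B :: "'a dclass multiset"
    assume "typ_cong (A + B) {#}"
    from typ_cong_null[OF this] show "typ_cong A {#} \<and> typ_cong B {#}"
      by (auto intro: typ_cong_empty)
  qed
qed

end

context conical_comm_monoid_add
begin

definition alg_le :: "'a \<Rightarrow> 'a \<Rightarrow> bool"
  where "alg_le x y \<longleftrightarrow> (\<exists>z. x + z = y)"

text \<open>The constant sum is the multiple \<open>(n + 1) x\<close>.\<close>

definition index_bound :: "'a \<Rightarrow> nat \<Rightarrow> bool"
  where "index_bound e n \<longleftrightarrow> (\<forall>x. alg_le (\<Sum>i<n + 1. x) e \<longrightarrow> x = 0)"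

definition index :: "'a \<Rightarrow> enat"
  where "index e = (if \<exists>n. index_bound e n then enat (LEAST n. index_bound e n) else \<infinity>)"

end

end

theory Submission
  imports Defs
begin

text \<open>
  The proof thinks of the elements of \<open>S\<close> as partial bijections, with \<open>sdom x\<close> and \<open>srng x\<close> in the
  roles of domain and range. The link between both conditions is the existence of a nonzero
  idempotent \<open>g\<close> having \<open>n + 1\<close> pairwise orthogonal copies for Green's relation \<open>D\<close>: this is what
  it means for the index of the type of some idempotent to exceed \<open>n\<close>, and it is also what an
  \<open>x\<close> with \<open>sdom (spow x n) \<noteq> srng (spow x n)\<close> provides.

  \<^emph>\<open>From powers to copies.\<close> Suppose that \<open>d(x\<^sup>n) \<le> r(x\<^sup>n)\<close> fails. Then already \<open>d(x\<^sup>n) \<le> r(x)\<close> fails: if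
  every point where \<open>x\<^sup>n\<close> is defined has a preimage under \<open>x\<close>, then that preimage
  is in the domain of \<open>x\<close> to the power \<open>n + 1\<close>, hence in that of \<open>x\<^sup>n\<close>, and iterating yields
  a preimage under \<open>x\<^sup>n\<close> (lemma \<open>sdom_spow_le_srng\<close>). The relative complement \<open>g\<close> of \<open>r(x)\<close> in
  \<open>d(x\<^sup>n)\<close> is therefore nonzero, and the images of \<open>g\<close> under the powers of \<open>x\<close> with exponents \<open>0, \<dots>, n\<close>
  are pairwise orthogonal, as \<open>g\<close> is disjoint from the range of \<open>x\<close>. Their join is an
  idempotent whose type is \<open>n + 1\<close> times the type of \<open>g\<close>. If no idempotent has such a type, then
  \<open>d(x\<^sup>n) \<le> r(x\<^sup>n)\<close> for all \<open>x\<close>, and replacing \<open>x\<close> by its inverse gives equality.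

  \<^emph>\<open>From copies to powers.\<close> Given orthogonal copies \<open>f\<^sub>0, \<dots>, f\<^sub>n\<close> of a nonzero idempotent, the join \<open>x\<close> of
  partial bijections \<open>f\<^sub>i \<rightarrow> f\<^sub>i\<^sub>+\<^sub>1\<close> for \<open>i < n\<close> is a shift: \<open>x\<^sup>n\<close> is defined on \<open>f\<^sub>0\<close>, which is disjoint from
  the range of \<open>x\<close> (lemma \<open>splits_replicate_shift\<close>).

  \<^emph>\<open>The type monoid.\<close> It remains to extract actual copies from an inequality in the type monoid,
  which is only presented by generators and relations. The relation \<open>splits A e\<close> says that \<open>e\<close> is an
  orthogonal join of idempotents whose classes make up the multiset \<open>A\<close>. For each fixed \<open>e\<close> this is
  invariant under the congruence defining the type monoid (lemma \<open>typ_cong_splits\<close>); the induction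
  over the generation of the congruence only needs that orthogonal joins in \<open>S\<close> and their
  decompositions can be transported along \<open>D\<close>. Hence if \<open>A\<close> represents the type of \<open>e\<close>, then \<open>e\<close>
  itself splits as prescribed by \<open>A\<close>.
\<close>

section \<open>Idempotents, domains and ranges in inverse semigroups\<close>

context inverse_semigroup
begin

lemma Idp_square: "e \<in> Idp \<Longrightarrow> e * e = e"
  by (simp add: Idp_def)

lemma Idp_square_left: "e \<in> Idp \<Longrightarrow> e * (e * x) = e * x"
  by (metis Idp_square mult.assoc)

lemma Idp_commute: "e \<in> Idp \<Longrightarrow> f \<in> Idp \<Longrightarrow> e * f = f * e"
  by (simp add: Idp_def idem_commute)

lemma Idp_left_commute: "e \<in> Idp \<Longrightarrow> f \<in> Idp \<Longrightarrow> e * (f * x) = f * (e * x)"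
  by (metis Idp_commute mult.assoc)

lemma Idp_mult: "e \<in> Idp \<Longrightarrow> f \<in> Idp \<Longrightarrow> e * f \<in> Idp"
  by (simp add: Idp_def idem_mult)

lemma sinv_sinv [simp]: "sinv (sinv x) = x"
  by (rule sinv_unique[OF sinv(2) sinv(1)])

lemma sdom_Idp [simp]: "sdom x \<in> Idp"
  by (simp add: Idp_def sdom_idem)

lemma srng_conv_sdom: "srng x = sdom (sinv x)"
  by (simp add: srng_def sdom_def)

lemma sdom_sinv [simp]: "sdom (sinv x) = srng x"
  by (simp add: srng_conv_sdom)

lemma srng_sinv [simp]: "srng (sinv x) = sdom x"
  by (simp add: srng_conv_sdom)

lemma srng_Idp [simp]: "srng x \<in> Idp"
  by (simp add: srng_conv_sdom del: sdom_sinv)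

lemma sinv_Idp: "e \<in> Idp \<Longrightarrow> sinv e = e"
  by (simp add: Idp_def sinv_idem)

lemma sdom_of_Idp: "e \<in> Idp \<Longrightarrow> sdom e = e"
  by (simp add: sdom_def sinv_Idp Idp_square)

lemma srng_of_Idp: "e \<in> Idp \<Longrightarrow> srng e = e"
  by (simp add: srng_def sinv_Idp Idp_square)

lemma mult_sdom: "x * sdom x = x"
  by (simp add: sdom_def sinv')

lemma srng_mult: "srng x * x = x"
  by (simp add: srng_def mult.assoc sinv')

lemma srng_mult_left: "srng x * (x * y) = x * y"
  by (metis mult.assoc srng_mult)

lemma sinv_mult: "sinv (x * y) = sinv y * sinv x"
proof -
  have c: "y * (sinv y * (sinv x * (x * t))) = sinv x * (x * (y * (sinv y * t)))" for t
    using Idp_left_commute[OF srng_Idp[of y] sdom_Idp[of x], of t]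
    by (simp add: srng_def sdom_def mult.assoc)
  show ?thesis
    by (rule sinv_unique) (simp_all add: mult.assoc c sinv', simp_all add: c[symmetric] sinv')
qed

lemma conj_Idp: "e \<in> Idp \<Longrightarrow> x * e * sinv x \<in> Idp"
proof -
  assume e: "e \<in> Idp"
  have "srng (x * e) = x * e * sinv x"
    by (simp add: srng_def sinv_mult sinv_Idp[OF e] mult.assoc Idp_square_left[OF e])
  thus ?thesis by (metis srng_Idp)
qed

lemma conj_Idp': "e \<in> Idp \<Longrightarrow> sinv x * e * x \<in> Idp"
  using conj_Idp[of e "sinv x"] by simp

lemma nat_le_Idp_iff: "e \<in> Idp \<Longrightarrow> nat_le e f \<longleftrightarrow> f * e = e"
  by (auto simp: nat_le_def sdom_of_Idp)

lemma nat_le_sdom: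
  assumes "nat_le x z" shows "sdom z * sdom x = sdom x"
proof -
  have x: "x = z * sdom x" using assms by (simp add: nat_le_def)
  hence "x * sdom z = x"
    by (metis Idp_commute mult.assoc mult_sdom sdom_Idp)
  hence "sdom x * sdom z = sdom x" by (metis mult.assoc sdom_def)
  thus ?thesis by (simp add: Idp_commute)
qed

lemma nat_le_srng:
  assumes "nat_le x z" shows "srng z * srng x = srng x"
  using assms unfolding nat_le_def
  by (metis mult.assoc srng_def srng_mult)

lemma greenD_sdom: "greenD x (sdom x)"
  by (auto simp: greenD_def greenL_def greenR_def sdom_of_Idp srng_of_Idp
      intro!: relcomppI[of _ _ "sdom x"])

lemma greenD_Idp_iff:
  assumes "e \<in> Idp" "f \<in> Idp"
  shows "greenD e f \<longleftrightarrow> (\<exists>s. sdom s = e \<and> srng s = f)"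
  using assms by (auto simp: greenD_def greenL_def greenR_def sdom_of_Idp srng_of_Idp)

end

section \<open>The Boolean algebra of idempotents\<close>

context boolean_inverse_semigroup
begin

text \<open>The join inside the lattice of idempotents is defined for all pairs of idempotents, unlike
  \<open>oplus\<close>, and obeys the lattice laws; it is used in place of \<open>oplus\<close> wherever idempotents are
  concerned.\<close>

definition isup :: "'a \<Rightarrow> 'a \<Rightarrow> 'a"
  where "isup e f = join \<lparr>carrier = Idp, eq = (=), le = nat_le\<rparr> e f"

lemma zero_Idp [simp]: "0 \<in> Idp"
  by (simp add: Idp_def)

context
begin

interpretation G: generalized_boolean_algebra "\<lparr>carrier = Idp, eq = (=), le = nat_le\<rparr>"
  by (rule gba_Idp)

lemma isup_Idp [simp]: "e \<in> Idp \<Longrightarrow> f \<in> Idp \<Longrightarrow> isup e f \<in> Idp"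
  using G.join_closed[of e f] by (simp add: isup_def)

lemma isup_left: "e \<in> Idp \<Longrightarrow> f \<in> Idp \<Longrightarrow> isup e f * e = e"
  using G.join_left[of e f] by (simp add: isup_def nat_le_Idp_iff)

lemma isup_right: "e \<in> Idp \<Longrightarrow> f \<in> Idp \<Longrightarrow> isup e f * f = f"
  using G.join_right[of e f] by (simp add: isup_def nat_le_Idp_iff)

lemma isup_least:
  "\<lbrakk>e \<in> Idp; f \<in> Idp; g \<in> Idp; g * e = e; g * f = f\<rbrakk> \<Longrightarrow> g * isup e f = isup e f"
  using G.join_le[of e g f] by (metis G.join_closed isup_def nat_le_Idp_iff
      partial_object.select_convs(1) gorder.select_convs(1))

lemma Idp_meet:
  assumes "e \<in> Idp" "f \<in> Idp"
  shows "meet \<lparr>carrier = Idp, eq = (=), le = nat_le\<rparr> e f = e * f"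
proof (rule nat_le_antisym)
  let ?m = "meet \<lparr>carrier = Idp, eq = (=), le = nat_le\<rparr> e f"
  have m: "?m \<in> Idp" using assms G.meet_closed[of e f] by simp
  have "e * ?m = ?m" "f * ?m = ?m"
    using assms G.meet_left[of e f] G.meet_right[of e f] m by (simp_all add: nat_le_Idp_iff)
  thus "nat_le ?m (e * f)" by (simp add: nat_le_Idp_iff m mult.assoc)
  show "nat_le (e * f) ?m"
    using assms G.meet_le[of "e * f" e f]
    by (simp add: Idp_mult nat_le_Idp_iff Idp_square_left Idp_left_commute[of f e] Idp_square)
qed

lemma mult_isup:
  assumes "g \<in> Idp" "e \<in> Idp" "f \<in> Idp"
  shows "g * isup e f = isup (g * e) (g * f)"
  using G.distrib[of g e f] assms isup_Idp[of e f]
  by (simp add: Idp_meet isup_def)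

lemma isup_commute: "isup e f = isup f e"
  by (simp add: isup_def join_def insert_commute)

lemma isup_assoc:
  "\<lbrakk>e \<in> Idp; f \<in> Idp; g \<in> Idp\<rbrakk> \<Longrightarrow> isup (isup e f) g = isup e (isup f g)"
  using G.weak_join_assoc[of e f g] by (simp add: isup_def)

text \<open>The relative complement of \<open>f \<sqinter> e\<close> in \<open>e\<close>; it is nonzero exactly because \<open>e \<le> f\<close> fails.\<close>

lemma Idp_complement:
  assumes "e \<in> Idp" "f \<in> Idp" "f * e \<noteq> e"
  obtains g where "g \<in> Idp" "e * g = g" "g * f = 0" "g \<noteq> 0"
proof -
  let ?L = "\<lparr>carrier = Idp, eq = (=), le = nat_le\<rparr>"
  have fe: "f * e \<in> Idp" "nat_le (f * e) e"
    using assms by (simp_all add: Idp_mult nat_le_Idp_iff Idp_left_commute[of e f] Idp_square)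
  then obtain g where g: "g \<in> Idp" "f * e * g = bottom ?L" "isup (f * e) g = e"
    using G.rel_compl[of "f * e" e] assms by (auto simp: Idp_meet isup_def)
  have "nat_le (bottom ?L) 0" using G.bottom_lower[of 0] by simp
  hence "bottom ?L = 0" by (simp add: nat_le_def)
  hence 0: "f * e * g = 0" using g by simp
  have eg: "e * g = g" using isup_right[OF fe(1) g(1)] g(3) by simp
  have "g * f = 0" using 0 eg by (simp add: Idp_commute[OF g(1) assms(2)] mult.assoc)
  moreover have "g \<noteq> 0"
  proof
    assume "g = 0"
    hence "f * e * e = e" using g isup_least[OF fe(1) g(1) fe(1)] Idp_square[OF fe(1)]
      by (metis mult_zero_right Idp_square assms(1) mult.assoc)
    thus False using assms by (simp add: mult.assoc Idp_square)
  qed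
  ultimately show ?thesis using that g(1) eg by blast
qed

end

lemma isup_0 [simp]: "e \<in> Idp \<Longrightarrow> isup e 0 = e"
  by (metis Idp_commute Idp_square isup_Idp isup_least isup_left mult_zero_right zero_Idp)

lemma isup_0_left [simp]: "e \<in> Idp \<Longrightarrow> isup 0 e = e"
  by (subst isup_commute) simp

lemma mult_isup_eq_0_iff:
  assumes "g \<in> Idp" "e \<in> Idp" "f \<in> Idp"
  shows "g * isup e f = 0 \<longleftrightarrow> g * e = 0 \<and> g * f = 0"
proof
  assume "g * isup e f = 0"
  thus "g * e = 0 \<and> g * f = 0"
    using assms by (metis isup_left isup_right mult.assoc mult_zero_left)
qed (use assms in \<open>simp add: mult_isup\<close>)

lemma isup_mult_eq_0_iff:
  assumes "g \<in> Idp" "e \<in> Idp" "f \<in> Idp"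
  shows "isup e f * g = 0 \<longleftrightarrow> e * g = 0 \<and> f * g = 0"
  using assms mult_isup_eq_0_iff[OF assms] by (simp add: Idp_commute)

text \<open>Conjugation by \<open>s\<close> is an order isomorphism from the idempotents below \<open>sdom s\<close> onto those
  below \<open>srng s\<close>, with conjugation by \<open>sinv s\<close> as inverse, so it preserves joins. For general \<open>e\<close> and
  \<open>f\<close> their meets with \<open>sdom s\<close> take their place, which is harmless by distributivity.\<close>

lemma conj_isup:
  assumes e: "e \<in> Idp" and f: "f \<in> Idp"
  shows "s * isup e f * sinv s = isup (s * e * sinv s) (s * f * sinv s)"
proof -
  let ?w = "isup (s * e * sinv s) (s * f * sinv s)" and ?u = "isup e f"
  have se: "s * e * sinv s \<in> Idp" and sf: "s * f * sinv s \<in> Idp" and su: "s * ?u * sinv s \<in> Idp"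
    using e f by (simp_all add: conj_Idp)
  have w: "?w \<in> Idp" using se sf by simp
  have push: "s * a * sinv s * (s * b * sinv s) = s * (a * b) * sinv s"
    if "a \<in> Idp" "b \<in> Idp" for a b
    using Idp_left_commute[OF sdom_Idp[of s] that(1), of "b * sinv s"] that
    by (simp add: sdom_def mult.assoc sinv')
       (metis mult.assoc Idp_commute sdom_Idp sdom_def sinv'(1,3) Idp_left_commute)
  have ge: "s * ?u * sinv s * ?w = ?w"
    using e f by (intro isup_least se sf su) (simp_all add: push isup_left isup_right)
  \<comment> \<open>The other inequality: pulling the right-hand side back to \<open>sdom s\<close> gives an upper bound.\<close>
  let ?v = "sinv s * ?w * s"
  have v: "?v \<in> Idp" using w by (rule conj_Idp')
  have pull: "?v * (sdom s * a) = sdom s * a"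
    if a: "a \<in> Idp" and wa: "?w * (s * a * sinv s) = s * a * sinv s" for a
  proof -
    have "?v * (sdom s * a) = ?v * (sdom s * a * sdom s)"
      using a by (metis Idp_commute Idp_square_left mult.assoc sdom_Idp)
    also have "\<dots> = sinv s * (?w * (s * a * sinv s)) * s"
      by (simp add: sdom_def mult.assoc sinv')
    also have "\<dots> = sdom s * a * sdom s" by (simp only: wa) (simp add: sdom_def mult.assoc)
    also have "\<dots> = sdom s * a"
      using a by (metis Idp_commute Idp_square_left mult.assoc sdom_Idp)
    finally show ?thesis .
  qed
  have "?v * isup (sdom s * e) (sdom s * f) = isup (sdom s * e) (sdom s * f)"
    using e f by (intro isup_least pull v isup_left[OF se sf] isup_right[OF se sf])
      (simp_all add: Idp_mult)
  hence 1: "?v * (sdom s * ?u) = sdom s * ?u" using e f by (simp add: mult_isup)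
  have "s * ?u * sinv s = s * (sdom s * ?u) * sinv s" by (simp add: sdom_def mult.assoc sinv')
  also have "\<dots> = s * (?v * (sdom s * ?u)) * sinv s" by (simp only: 1)
  also have "\<dots> = srng s * (?w * (s * ?u * sinv s))"
    by (simp add: sdom_def srng_def mult.assoc sinv')
  also have "\<dots> = ?w * (srng s * (s * ?u * sinv s))" by (rule Idp_left_commute[OF srng_Idp w])
  also have "\<dots> = ?w * (s * ?u * sinv s)" by (simp only: srng_mult_left mult.assoc)
  also have "\<dots> = ?w" using ge by (simp add: Idp_commute[OF w su])
  finally show ?thesis .
qed

section \<open>Orthogonal joins and their transport along Green's relation D\<close>

lemma oplus_absorb:
  assumes "orthogonal x y"
  shows "oplus x y * sdom x = x" "oplus x y * sdom y = y"
  using is_join_oplus[OF assms] by (auto simp: is_join_def nat_le_def)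

text \<open>Restricting \<open>x \<oplus> y\<close> to the join of the two domains still gives an upper bound of \<open>x\<close> and \<open>y\<close>,
  so the least upper bound has no larger domain. The range is treated in the same way.\<close>

lemma sdom_oplus:
  assumes "orthogonal x y"
  shows "sdom (oplus x y) = isup (sdom x) (sdom y)"
proof -
  let ?z = "oplus x y" and ?e = "isup (sdom x) (sdom y)"
  note j = is_join_oplus[OF assms]
  have le: "sdom ?z * ?e = ?e"
    using j by (intro isup_least) (auto simp: is_join_def nat_le_sdom)
  have "nat_le x (?z * ?e)" "nat_le y (?z * ?e)"
    using oplus_absorb[OF assms] by (auto simp: nat_le_def mult.assoc isup_left isup_right)
  hence "nat_le ?z (?z * ?e)" using j by (auto simp: is_join_def)
  hence "?z = ?z * ?e * sdom ?z" by (simp add: nat_le_def)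
  hence "sdom ?z * ?e * sdom ?z = sdom ?z" by (metis mult.assoc sdom_def)
  thus ?thesis using le by (metis Idp_commute isup_Idp sdom_Idp Idp_square_left)
qed

lemma srng_oplus:
  assumes "orthogonal x y"
  shows "srng (oplus x y) = isup (srng x) (srng y)"
proof -
  let ?z = "oplus x y" and ?e = "isup (srng x) (srng y)"
  note j = is_join_oplus[OF assms]
  have le: "srng ?z * ?e = ?e"
    using j by (intro isup_least) (auto simp: is_join_def nat_le_srng)
  have "?e * x = x" "?e * y = y"
    by (metis isup_left isup_right mult.assoc srng_Idp srng_mult)+
  hence "nat_le x (?e * ?z)" "nat_le y (?e * ?z)"
    using oplus_absorb[OF assms] by (auto simp: nat_le_def mult.assoc)
  hence "nat_le ?z (?e * ?z)" using j by (auto simp: is_join_def)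
  hence "?z = ?e * ?z" by (simp add: nat_le_def mult.assoc mult_sdom)
  hence "?e * srng ?z = srng ?z" by (metis mult.assoc srng_def)
  thus ?thesis using le by (metis Idp_commute isup_Idp srng_Idp)
qed

lemma orthogonal_iff:
  "orthogonal x y \<longleftrightarrow> sdom x * sdom y = 0 \<and> srng x * srng y = 0"
proof
  assume "orthogonal x y"
  hence "sinv x * y = 0" "x * sinv y = 0" by (auto simp: orthogonal_def)
  thus "sdom x * sdom y = 0 \<and> srng x * srng y = 0"
    unfolding sdom_def srng_def by (metis mult.assoc mult_zero_left mult_zero_right)
next
  assume *: "sdom x * sdom y = 0 \<and> srng x * srng y = 0"
  have "sinv x * y = sinv x * (srng x * srng y) * y"
    by (simp add: srng_def mult.assoc sinv')
  moreover have "x * sinv y = x * (sdom x * sdom y) * sinv y"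
    by (simp add: sdom_def mult.assoc sinv')
  ultimately show "orthogonal x y" using * by (simp add: orthogonal_def)
qed

text \<open>Partial bijections \<open>e \<rightarrow> e'\<close> and \<open>f \<rightarrow> f'\<close> are orthogonal, and their join is a partial bijection
  between the joins. Thus the partial addition of \<open>D\<close>-classes is well defined.\<close>

lemma greenD_isup:
  assumes "e \<in> Idp" "f \<in> Idp" "e' \<in> Idp" "f' \<in> Idp" "e * f = 0" "e' * f' = 0"
    and "greenD e e'" "greenD f f'"
  shows "greenD (isup e f) (isup e' f')"
proof -
  obtain s t where "sdom s = e" "srng s = e'" "sdom t = f" "srng t = f'"
    using assms by (auto simp: greenD_Idp_iff)
  moreover from this have "orthogonal s t" using assms by (simp add: orthogonal_iff)
  ultimately show ?thesis
    using sdom_oplus[of s t] srng_oplus[of s t] assms by (subst greenD_Idp_iff) auto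
qed

text \<open>A partial bijection \<open>e \<oplus> f \<rightarrow> h\<close> carries the decomposition of its domain to one of its range.
  This is the refinement property that makes the invariance of \<open>splits\<close> work.\<close>

lemma greenD_isup_split:
  assumes e: "e \<in> Idp" and f: "f \<in> Idp" and h: "h \<in> Idp" and "e * f = 0"
    and "greenD (isup e f) h"
  obtains e' f' where "e' \<in> Idp" "f' \<in> Idp" "e' * f' = 0" "h = isup e' f'"
    "greenD e e'" "greenD f f'"
proof -
  obtain s where s: "sdom s = isup e f" "srng s = h"
    using assms by (auto simp: greenD_Idp_iff)
  have D: "greenD a (s * a * sinv s)" if a: "a \<in> Idp" "sdom s * a = a" for a
  proof -
    have "sdom (s * a) = a * (sdom s * a)"
      by (simp add: sdom_def sinv_mult sinv_Idp[OF a(1)] mult.assoc)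
    moreover have "srng (s * a) = s * a * sinv s"
      by (simp add: srng_def sinv_mult sinv_Idp[OF a(1)] mult.assoc Idp_square_left[OF a(1)])
    ultimately show ?thesis using a by (auto simp: greenD_Idp_iff conj_Idp Idp_square)
  qed
  show ?thesis
  proof
    show "s * e * sinv s \<in> Idp" "s * f * sinv s \<in> Idp" using e f by (simp_all add: conj_Idp)
    show "greenD e (s * e * sinv s)" "greenD f (s * f * sinv s)"
      using e f s by (auto intro!: D simp: isup_left isup_right)
    have "s * e * sinv s * (s * f * sinv s) = s * (e * (sdom s * f)) * sinv s"
      by (simp add: sdom_def mult.assoc)
    thus "s * e * sinv s * (s * f * sinv s) = 0"
      using e f s \<open>e * f = 0\<close> by (simp add: isup_right)
    have "h = s * sdom s * sinv s" unfolding mult_sdom using s by (simp add: srng_def)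
    thus "h = isup (s * e * sinv s) (s * f * sinv s)"
      using e f s by (simp add: conj_isup)
  qed
qed

end

section \<open>Splitting an idempotent according to a multiset of classes\<close>

text \<open>\<open>splits A e\<close> holds iff \<open>e\<close> is the join of pairwise orthogonal idempotents, one in each
  class listed by \<open>A\<close>. Adding one idempotent at a time avoids indexed families; that the order of
  the additions does not matter is lemma \<open>splits_add_msetE\<close>.\<close>

inductive splits :: "'a::boolean_inverse_semigroup dclass multiset \<Rightarrow> 'a \<Rightarrow> bool"
  where
    splits_empty: "splits {#} 0"
  | splits_add: "\<lbrakk>splits A e; e \<in> Idp; f \<in> Idp; e * f = 0\<rbrakk>
      \<Longrightarrow> splits (add_mset (dcl f) A) (isup e f)"

lemma dcl_eq_iff: "dcl x = dcl y \<longleftrightarrow> greenD x y"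
  by transfer simp

lemma dcl_Idp_cases: obtains e where "e \<in> Idp" "a = dcl e"
proof -
  obtain x where "a = dcl x" by transfer (metis equivp_greenD equivp_reflp)
  moreover have "dcl x = dcl (sdom x)" by (simp add: dcl_eq_iff greenD_sdom)
  ultimately show ?thesis using that[of "sdom x"] by simp
qed

lemma splits_Idp: "splits A e \<Longrightarrow> e \<in> Idp"
  by (induction rule: splits.induct) simp_all

lemma splits_empty_iff [simp]: "splits {#} e \<longleftrightarrow> e = 0"
  by (auto intro: splits.intros elim: splits.cases)

text \<open>Any member of the multiset may be regarded as the one added last, because orthogonal joins
  are commutative and associative.\<close>

lemma splits_add_msetE:
  assumes "splits (add_mset a A) e"
  obtains g f where "splits A g" "g \<in> Idp" "f \<in> Idp" "g * f = 0" "a = dcl f" "e = isup g f"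
proof -
  have "\<exists>g f. splits A g \<and> g \<in> Idp \<and> f \<in> Idp \<and> g * f = 0 \<and> a = dcl f \<and> e = isup g f"
    using assms
  proof (induction "add_mset a A" e arbitrary: A rule: splits.induct)
    case (splits_add B e h)
    show ?case
    proof (cases "dcl h = a \<and> B = A")
      case True
      thus ?thesis using splits_add by blast
    next
      case False
      then obtain K where K: "B = add_mset a K" "A = add_mset (dcl h) K"
        using splits_add.hyps by (auto simp: add_eq_conv_ex)
      with splits_add.hyps(2) obtain g f where *: "splits K g" "g \<in> Idp" "f \<in> Idp" "g * f = 0"
          "a = dcl f" "e = isup g f"
        by blast
      have gh: "g * h = 0" "f * h = 0"
        using splits_add.hyps(4-6) * by (simp_all add: isup_mult_eq_0_iff)
      have "splits A (isup g h)" using K * gh splits_add.hyps by (auto intro: splits.intros)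
      moreover have "isup g h * f = 0"
        using * gh splits_add.hyps by (simp add: isup_mult_eq_0_iff Idp_commute[of h f])
      moreover have "isup e h = isup (isup g h) f"
        using * splits_add.hyps by (simp add: isup_assoc isup_commute[of f h])
      moreover have "isup g h \<in> Idp" using * splits_add.hyps by simp
      ultimately show ?thesis using *(3,5) by blast
    qed
  qed simp
  thus ?thesis using that by blast
qed

lemma splits_single: "splits {#a#} e \<longleftrightarrow> e \<in> Idp \<and> dcl e = a"
proof
  assume "splits {#a#} e"
  thus "e \<in> Idp \<and> dcl e = a" by (auto elim!: splits_add_msetE)
next
  assume "e \<in> Idp \<and> dcl e = a"
  thus "splits {#a#} e" using splits_add[OF splits_empty, of e] by auto
qed

text \<open>This makes \<open>splits\<close> compatible with sums of multisets, hence with the closure of the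
  congruence under addition.\<close>

lemma splits_union:
  "splits (A + B) e \<longleftrightarrow>
    (\<exists>g h. splits A g \<and> splits B h \<and> g * h = 0 \<and> e = isup g h)"
proof (induction B arbitrary: e)
  case empty
  have "isup g 0 = g" if "splits A g" for g using splits_Idp[OF that] by simp
  thus ?case by auto
next
  case (add b B)
  show ?case
  proof
    assume "splits (A + add_mset b B) e"
    then obtain k f where k: "splits (A + B) k" "f \<in> Idp" "k * f = 0" "b = dcl f" "e = isup k f"
      by (auto elim: splits_add_msetE)
    then obtain g h where gh: "splits A g" "splits B h" "g * h = 0" "k = isup g h"
      using add.IH by blast
    have I: "g \<in> Idp" "h \<in> Idp" using gh splits_Idp by auto
    have 0: "g * f = 0" "h * f = 0" using k gh I by (simp_all add: isup_mult_eq_0_iff)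
    have "splits (add_mset b B) (isup h f)" using gh k I 0 by (auto intro: splits.intros)
    moreover have "g * isup h f = 0" using gh I k 0 by (simp add: mult_isup)
    moreover have "e = isup g (isup h f)" using gh I k by (simp add: isup_assoc)
    ultimately show "\<exists>g h. splits A g \<and> splits (add_mset b B) h \<and> g * h = 0 \<and> e = isup g h"
      using gh by blast
  next
    assume "\<exists>g h. splits A g \<and> splits (add_mset b B) h \<and> g * h = 0 \<and> e = isup g h"
    then obtain g h f where gh: "splits A g" "splits B h" "h \<in> Idp" "f \<in> Idp" "h * f = 0"
        "b = dcl f" "g * isup h f = 0" "e = isup g (isup h f)"
      by (auto elim: splits_add_msetE)
    have I: "g \<in> Idp" using gh splits_Idp by auto
    have 0: "g * h = 0" "g * f = 0" using gh I by (simp_all add: mult_isup_eq_0_iff)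
    have "splits (A + B) (isup g h)" using gh 0 add.IH by blast
    moreover have "isup g h * f = 0" using gh I 0 by (simp add: isup_mult_eq_0_iff)
    moreover have "e = isup (isup g h) f" using gh I by (simp add: isup_assoc)
    ultimately show "splits (A + add_mset b B) e"
      using gh I splits_add[of "A + B" "isup g h" f] by simp
  qed
qed

text \<open>The defining relations of the type monoid. From left to right, the classes of two
  orthogonal idempotents determine the class of their join; from right to left, the decomposition
  of \<open>sdom (x \<oplus> y)\<close> into \<open>sdom x\<close> and \<open>sdom y\<close> is carried over to \<open>e\<close>.\<close>

lemma splits_pair:
  assumes "int_sum a b c"
  shows "splits {#a, b#} e \<longleftrightarrow> splits {#c#} e"
proof -
  obtain x y where xy: "orthogonal x y" "a = dcl x" "b = dcl y" "c = dcl (oplus x y)"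
    using assms by (auto elim: int_sum.cases)
  let ?f = "sdom x" and ?g = "sdom y"
  have a: "a = dcl ?f" and b: "b = dcl ?g" and c: "c = dcl (isup ?f ?g)"
    using xy greenD_sdom[of x] greenD_sdom[of y] greenD_sdom[of "oplus x y"]
    by (simp_all add: dcl_eq_iff sdom_oplus)
  have 0: "?f * ?g = 0" using xy by (simp add: orthogonal_iff)
  have "splits {#a, b#} e \<longleftrightarrow> (\<exists>g h. splits {#a#} g \<and> splits {#b#} h \<and> g * h = 0 \<and> e = isup g h)"
    using splits_union[of "{#a#}" "{#b#}" e] by (simp add: add_mset_commute)
  also have "\<dots> \<longleftrightarrow> splits {#c#} e"
  proof
    assume "\<exists>g h. splits {#a#} g \<and> splits {#b#} h \<and> g * h = 0 \<and> e = isup g h"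
    thus "splits {#c#} e"
      using 0 by (auto simp: splits_single a b c dcl_eq_iff intro: greenD_isup)
  next
    assume "splits {#c#} e"
    hence e: "e \<in> Idp" "greenD (isup ?f ?g) e"
      by (auto simp: splits_single c dcl_eq_iff equivp_symp[OF equivp_greenD])
    obtain e' f' where "e' \<in> Idp" "f' \<in> Idp" "e' * f' = 0" "e = isup e' f'"
        "greenD ?f e'" "greenD ?g f'"
      by (rule greenD_isup_split[OF _ _ e(1) 0 e(2)]) simp_all
    thus "\<exists>g h. splits {#a#} g \<and> splits {#b#} h \<and> g * h = 0 \<and> e = isup g h"
      unfolding splits_single a b dcl_eq_iff by (blast intro: equivp_symp[OF equivp_greenD])
  qed
  finally show ?thesis .
qed

lemma typ_cong_splits: "typ_cong A B \<Longrightarrow> splits A e \<longleftrightarrow> splits B e"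
proof (induction arbitrary: e rule: typ_cong.induct)
  case typ_cong_zero
  show ?case by (auto simp: splits_single dcl_eq_0_iff)
next
  case (typ_cong_sum a b c)
  thus ?case by (rule splits_pair)
next
  case (typ_cong_add A B C D)
  thus ?case by (simp add: splits_union)
qed simp_all

section \<open>Types of idempotents\<close>

lemma typS_eq_0_iff: "typS x = 0 \<longleftrightarrow> x = 0"
proof
  assume "typS x = 0"
  hence "typ_cong {#dcl x#} {#}"
    by (simp add: typS.abs_eq zero_type_monoid_def type_monoid.abs_eq_iff)
  from typ_cong_null[OF this] show "x = 0" by (simp add: dcl_eq_0_iff)
next
  assume "x = 0"
  thus "typS x = 0"
    by (simp add: typS.abs_eq zero_type_monoid_def type_monoid.abs_eq_iff typ_cong_zero)
qed

lemma typS_add: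
  assumes "orthogonal x y"
  shows "typS x + typS y = typS (oplus x y)"
proof -
  have "typ_cong {#dcl x, dcl y#} {#dcl (oplus x y)#}"
    using assms by (intro typ_cong_sum int_sum.intros)
  thus ?thesis
    by (simp add: typS.abs_eq plus_type_monoid.abs_eq type_monoid.abs_eq_iff add_mset_commute)
qed

lemma typS_greenD: "greenD x y \<Longrightarrow> typS x = typS y"
  by (simp add: typS.abs_eq flip: dcl_eq_iff)

lemma typS_isup:
  assumes "e \<in> Idp" "f \<in> Idp" "e * f = 0"
  shows "typS (isup e f) = typS e + typS f"
proof -
  have o: "orthogonal e f" using assms by (simp add: orthogonal_iff sdom_of_Idp srng_of_Idp)
  have "typS (isup e f) = typS (oplus e f)"
    using greenD_sdom[of "oplus e f"] assms
    by (simp add: sdom_oplus[OF o] sdom_of_Idp typS_greenD)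
  thus ?thesis by (simp add: typS_add[OF o])
qed

lemma abs_type_monoid_sum_const:
  "(\<Sum>i<m. abs_type_monoid X) = abs_type_monoid (repeat_mset m X)"
  by (induction m)
     (simp_all add: zero_type_monoid_def plus_type_monoid.abs_eq add.commute)

text \<open>An inequality in the type monoid is witnessed inside \<open>S\<close>: the type of \<open>e\<close> is represented both
  by \<open>{#dcl e#}\<close>, according to which \<open>e\<close> splits trivially, and by \<open>m\<close> copies of a multiset
  representing \<open>x\<close> plus a rest, so \<open>e\<close> splits according to the latter as well. As \<open>x \<noteq> 0\<close>, some
  class in the representing multiset is nonzero, and it occurs \<open>m\<close> times.\<close>

lemma multiple_le_typS_splits:
  fixes x :: "'a::boolean_inverse_semigroup type_monoid"
  assumes "alg_le (\<Sum>i<m. x) (typS e)" "e \<in> Idp" "x \<noteq> 0"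
  obtains f R where "f \<noteq> 0" "f \<in> Idp" "splits (replicate_mset m (dcl f) + R) e"
proof -
  obtain z where z: "(\<Sum>i<m. x) + z = typS e" using assms by (auto simp: alg_le_def)
  have rep: "\<exists>X. t = abs_type_monoid X" for t :: "'a type_monoid"
    by (induct t rule: type_monoid.abs_induct) blast
  obtain X where X: "x = abs_type_monoid X" using rep by blast
  obtain Z where Z: "z = abs_type_monoid Z" using rep by blast
  have "typ_cong (repeat_mset m X + Z) {#dcl e#}"
    using z unfolding X Z abs_type_monoid_sum_const plus_type_monoid.abs_eq typS.abs_eq
    by (simp add: type_monoid.abs_eq_iff)
  moreover have "splits {#dcl e#} e" using assms by (simp add: splits_single)
  ultimately have s: "splits (repeat_mset m X + Z) e" using typ_cong_splits by blast
  have "\<not> (\<forall>a\<in>#X. a = dcl 0)"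
  proof
    assume "\<forall>a\<in>#X. a = dcl 0"
    hence "typ_cong X {#}" by (rule typ_cong_empty)
    hence "x = 0" unfolding X zero_type_monoid_def by (simp add: type_monoid.abs_eq_iff)
    thus False using assms by simp
  qed
  then obtain a where a: "a \<in># X" "a \<noteq> dcl 0" by blast
  obtain f where f: "f \<in> Idp" "a = dcl f" by (rule dcl_Idp_cases)
  obtain X' where "X = add_mset (dcl f) X'" using a f by (metis multi_member_split)
  hence "repeat_mset m X + Z = replicate_mset m (dcl f) + (repeat_mset m X' + Z)"
    by (simp add: add.assoc)
  with s have "splits (replicate_mset m (dcl f) + (repeat_mset m X' + Z)) e" by simp
  moreover have "f \<noteq> 0" using a f by auto
  ultimately show ?thesis using that f by blast
qed

section \<open>Powers\<close>

lemma spow_Suc_0: "spow x (Suc 0) = x"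
  by (simp add: spow_def)

lemma spow_Suc: "n > 0 \<Longrightarrow> spow x (Suc n) = spow x n * x"
  by (cases n) (simp_all add: spow_def)

lemma spow_Suc': "n > 0 \<Longrightarrow> spow x (Suc n) = x * spow x n"
proof (induction n rule: nat_induct_non_zero)
  case 1
  show ?case using spow_Suc[of 1 x] by (simp add: spow_Suc_0)
next
  case (Suc n)
  thus ?case by (simp add: spow_Suc mult.assoc)
qed

text \<open>For lack of a unit, \<open>x\<close> to the power \<open>0\<close> makes sense only when applied to something.
  Iterated left multiplication covers exponent \<open>0\<close>, which the inductions below start from.\<close>

lemma spow_mult: "n > 0 \<Longrightarrow> spow x n * y = ((*) x ^^ n) y"
  by (induction n rule: nat_induct_non_zero) (simp_all add: spow_Suc_0 spow_Suc' mult.assoc)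

lemma sinv_spow: "n > 0 \<Longrightarrow> sinv (spow x n) = spow (sinv x) n"
proof (induction n rule: nat_induct_non_zero)
  case (Suc n)
  have "sinv (spow x (Suc n)) = sinv (spow x n * x)" using Suc by (simp only: spow_Suc)
  also have "\<dots> = spow (sinv x) (Suc n)" using Suc by (simp add: sinv_mult spow_Suc')
  finally show ?case .
qed (simp add: spow_Suc_0)

lemma funpow_mult_assoc:
  fixes x :: "'a::semigroup_mult"
  shows "((*) x ^^ m) (y * z) = ((*) x ^^ m) y * z"
  by (induction m) (simp_all add: mult.assoc)

section \<open>Orthogonal copies of an idempotent yield a shift\<close>

text \<open>The element \<open>x\<close> shifts the copies one step along a chain starting at \<open>f\<close>, and \<open>f\<close> is outside
  its range. In the induction the new copy \<open>h\<close> is put at the front of the chain: \<open>x\<close> is extended by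
  a partial bijection \<open>s : h \<rightarrow> f\<close>. The extension agrees with \<open>x\<close> on the old copies,
  whose join is \<open>g'\<close>, so after one step from \<open>h\<close> to \<open>f\<close> the old shift takes over. This is why
  \<open>x\<close> has to live inside \<open>g\<close> on both sides.\<close>

lemma splits_replicate_shift:
  assumes "splits (replicate_mset (Suc m) (dcl a)) g" "a \<noteq> 0"
  shows "\<exists>x f. f \<in> Idp \<and> dcl f = dcl a \<and> g * f = f \<and> f * x = 0 \<and> g * x = x \<and> x * g = x
    \<and> ((*) x ^^ m) f \<noteq> 0"
  using assms(1)
proof (induction m arbitrary: g)
  case 0
  \<comment> \<open>A single copy is a chain of length zero: \<open>x = 0\<close> and \<open>f = g\<close>.\<close>
  hence "g \<in> Idp" "dcl g = dcl a" by (simp_all add: splits_single)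
  moreover from this have "g \<noteq> 0" using assms(2) dcl_eq_0_iff by metis
  ultimately show ?case by (intro exI[of _ 0] exI[of _ g]) (simp add: Idp_square)
next
  case (Suc m)
  from Suc.prems have "splits (add_mset (dcl a) (replicate_mset (Suc m) (dcl a))) g" by simp
  then obtain g' h where gh: "splits (replicate_mset (Suc m) (dcl a)) g'"
      "g' \<in> Idp" "h \<in> Idp" "g' * h = 0" "dcl a = dcl h" "g = isup g' h"
    by (elim splits_add_msetE)
  obtain x f where xf: "f \<in> Idp" "dcl f = dcl a" "g' * f = f" "f * x = 0" "g' * x = x"
      "x * g' = x" "((*) x ^^ m) f \<noteq> 0"
    using Suc.IH[OF gh(1)] by blast
  have hg: "h * g' = 0" using gh by (simp add: Idp_commute)
  have "greenD h f" using xf gh by (simp flip: dcl_eq_iff)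
  then obtain s where s: "sdom s = h" "srng s = f" using gh xf by (auto simp: greenD_Idp_iff)
  have fs: "f * s = s" and sh: "s * h = s" using s srng_mult mult_sdom by blast+
  have gs: "g' * s = s" using fs xf(3) by (metis mult.assoc)
  have sg: "s * g' = 0" using sh hg by (metis mult.assoc mult_zero_right)
  have dx: "sdom x * g' = sdom x" using xf by (simp add: sdom_def mult.assoc)
  have o: "orthogonal x s"
  proof -
    have "sdom x * sdom s = 0" using dx gh by (metis mult.assoc mult_zero_right s(1))
    moreover have "srng x * srng s = 0"
      using xf by (simp add: s Idp_commute[OF srng_Idp xf(1)])
        (simp add: srng_def mult.assoc[symmetric])
    ultimately show ?thesis by (simp add: orthogonal_iff)
  qed
  let ?z = "oplus x s"
  have dz: "sdom ?z = isup (sdom x) h" and rz: "srng ?z = isup (srng x) f"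
    using sdom_oplus[OF o] srng_oplus[OF o] s by simp_all
  have rx: "g' * srng x = srng x" using xf by (simp add: srng_def mult.assoc[symmetric])
  have zg: "?z * g' = x"
  proof -
    have "?z * g' = ?z * (isup (sdom x) h * g')" by (metis dz mult.assoc mult_sdom)
    also have "isup (sdom x) h * g' = isup (g' * sdom x) (g' * h)"
      using gh by (simp add: Idp_commute[of _ g'] mult_isup)
    also have "\<dots> = sdom x" using gh dx by (simp add: Idp_commute[of g'])
    finally show ?thesis using oplus_absorb[OF o] by simp
  qed
  have zh: "?z * h = s" using oplus_absorb(2)[OF o] s by simp
  have pow: "((*) ?z ^^ k) s = ((*) x ^^ k) s \<and> g' * ((*) x ^^ k) s = ((*) x ^^ k) s" for k
  proof (induction k)
    case (Suc k)
    thus ?case using zg xf(5) by simp (metis mult.assoc)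
  qed (simp add: gs)
  have "((*) ?z ^^ Suc m) h = ((*) ?z ^^ m) s" by (simp add: funpow_swap1 zh)
  also have "\<dots> = ((*) x ^^ m) s" using pow by blast
  finally have p: "((*) ?z ^^ Suc m) h = ((*) x ^^ m) s" .
  have "((*) x ^^ m) s * sinv s = ((*) x ^^ m) f"
    using s by (simp flip: funpow_mult_assoc add: srng_def)
  hence nz: "((*) ?z ^^ Suc m) h \<noteq> 0" using p xf(7) by auto
  have hz: "h * ?z = 0"
  proof -
    have "h * srng x = 0" "h * f = 0" using rx xf hg by (metis mult.assoc mult_zero_left)+
    hence "h * srng ?z = 0" using gh xf by (simp add: rz mult_isup)
    thus ?thesis by (metis mult.assoc mult_zero_left srng_mult)
  qed
  have gg: "g \<in> Idp" "g * g' = g'" "g * h = h" using gh by (simp_all add: isup_left isup_right)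
  have gz: "g * ?z = ?z"
  proof -
    have "g * srng ?z = srng ?z" unfolding rz
      using gg rx xf by (intro isup_least) (simp_all, metis mult.assoc, metis mult.assoc)
    thus ?thesis by (metis mult.assoc srng_mult)
  qed
  have "?z * g = ?z"
  proof -
    have "sdom ?z * g = sdom ?z"
    proof -
      have "g * sdom x = sdom x" using gg dx gh
        by (metis Idp_commute mult.assoc sdom_Idp)
      hence "g * sdom ?z = sdom ?z" unfolding dz using gg gh by (intro isup_least) simp_all
      thus ?thesis using gg by (simp add: Idp_commute)
    qed
    thus ?thesis by (metis mult.assoc mult_sdom)
  qed
  thus ?case using gh gg hz gz nz by metis
qed

section \<open>The index and the main equivalence\<close>

text \<open>The least bound is at most \<open>n\<close> iff \<open>n\<close> is a bound itself, as bounds are upward closed: a larger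
  multiple of \<open>x\<close> below \<open>e\<close> has every smaller multiple below \<open>e\<close> too.\<close>

lemma index_le_iff:
  "index e \<le> enat n \<longleftrightarrow> index_bound e n"
proof
  have mono: "index_bound e m \<Longrightarrow> m \<le> n \<Longrightarrow> index_bound e n" for m
    unfolding index_bound_def
  proof (intro allI impI)
    fix x assume *: "\<forall>x. alg_le (\<Sum>i<m + 1. x) e \<longrightarrow> x = 0" "m \<le> n" "alg_le (\<Sum>i<n + 1. x) e"
    have "(\<Sum>i<n + 1. x) = (\<Sum>i<m + 1. x) + (\<Sum>i\<in>{m+1..<n+1}. x)"
      using *(2)
      by (metis Suc_eq_plus1 Suc_le_mono atLeast0LessThan le0 sum.atLeastLessThan_concat)
    with * show "x = 0" unfolding alg_le_def by (metis add.assoc)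
  qed
  {
    assume le: "index e \<le> enat n"
    hence ex: "\<exists>n. index_bound e n" by (auto simp: index_def split: if_splits)
    with le have "(LEAST n. index_bound e n) \<le> n" by (simp add: index_def)
    thus "index_bound e n" using mono LeastI_ex[OF ex] by blast
  }
  assume "index_bound e n"
  thus "index e \<le> enat n" by (auto simp: index_def intro: Least_le)
qed

text \<open>Otherwise \<open>e\<close> contains \<open>n + 1\<close> orthogonal copies of a nonzero idempotent. For the
  resulting shift \<open>x\<close>, the power \<open>x\<^sup>n\<close> is nonzero on \<open>f\<close>, while its range, and hence by assumption
  its domain, is disjoint from \<open>f\<close>.\<close>

lemma index_bound_if_power_domains:
  fixes e :: "'a::boolean_inverse_semigroup"
  assumes n: "n > 0" and dr: "\<And>x :: 'a. sdom (spow x n) = srng (spow x n)" and e: "e \<in> Idp"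
  shows "index_bound (typS e) n"
  unfolding index_bound_def
proof (intro allI impI, rule ccontr)
  fix t assume t: "alg_le (\<Sum>i<n + 1. t) (typS e)" "t \<noteq> 0"
  obtain a R where a: "a \<noteq> 0" "a \<in> Idp" "splits (replicate_mset (n + 1) (dcl a) + R) e"
    by (rule multiple_le_typS_splits[OF t(1) e t(2)])
  then obtain g where g: "splits (replicate_mset (Suc n) (dcl a)) g"
    unfolding Suc_eq_plus1 splits_union by blast
  then obtain x f :: 'a where xf: "f \<in> Idp" "f * x = 0" "((*) x ^^ n) f \<noteq> 0"
    using splits_replicate_shift[OF g a(1)] by blast
  have "f * spow x n = 0"
    using n xf(2) by (cases n; cases "n - 1")
      (auto simp: spow_Suc_0 spow_Suc' mult.assoc[symmetric])
  hence "f * sdom (spow x n) = 0" by (simp add: dr srng_def mult.assoc[symmetric])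
  hence "sdom (spow x n) * f = 0" using xf by (simp add: Idp_commute)
  hence "spow x n * f = 0" by (metis mult.assoc mult_sdom mult_zero_right)
  thus False using xf n by (simp add: spow_mult)
qed

text \<open>Write \<open>d\<close> for \<open>sdom (spow x n)\<close>. If \<open>d \<le> srng x\<close>, then \<open>d\<close> is the image under \<open>x\<close> of its own
  preimage, and this preimage is the domain of \<open>spow x (n + 1)\<close>, so it lies below \<open>d\<close>. Thus \<open>d\<close> is
  contained in its image under \<open>x\<close>, and therefore in its image under each power of \<open>x\<close>.
  Containment in the image under \<open>y\<close> is expressed below as \<open>d = y * d * w\<close> for some \<open>w\<close>, which
  composes without computing any inverse.\<close>

lemma sdom_spow_le_srng:
  fixes x :: "'a::inverse_semigroup"
  assumes n: "n > 0" and le: "srng x * sdom (spow x n) = sdom (spow x n)"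
  shows "srng (spow x n) * sdom (spow x n) = sdom (spow x n)"
proof -
  let ?d = "sdom (spow x n)"
  have "sdom (x * spow x n) * ?d = sdom (x * spow x n)"
    by (simp add: sdom_def sinv_mult mult.assoc sinv')
  moreover have "sdom (x * spow x n) = sinv x * ?d * x"
    using n by (simp flip: spow_Suc' add: spow_Suc) (simp add: sdom_def sinv_mult mult.assoc)
  ultimately have "sinv x * ?d * x * ?d = sinv x * ?d * x" by simp
  hence dd: "?d * (sinv x * ?d * x) = sinv x * ?d * x"
    by (metis Idp_commute conj_Idp' sdom_Idp)
  have "?d = srng x * ?d * srng x"
    using le by (metis Idp_commute sdom_Idp srng_Idp)
  also have "\<dots> = x * (sinv x * ?d * x) * sinv x" by (simp add: srng_def mult.assoc)
  also have "\<dots> = x * ?d * (sinv x * ?d * x * sinv x)"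
    by (subst dd[symmetric]) (simp only: mult.assoc)
  finally obtain v where v: "?d = x * ?d * v" by blast
  have "\<exists>w. ?d = spow x k * ?d * w" if "k > 0" for k
    using that
  proof (induction k rule: nat_induct_non_zero)
    case 1
    show ?case using v by (auto simp: spow_Suc_0)
  next
    case (Suc k)
    then obtain w where "?d = spow x k * ?d * w" by blast
    hence "?d = spow x k * (x * ?d * v) * w" using v by simp
    hence "?d = spow x (Suc k) * ?d * (v * w)" using Suc.hyps by (simp add: spow_Suc mult.assoc)
    thus ?case by blast
  qed
  then obtain w where "?d = spow x n * ?d * w" using n by blast
  thus ?thesis by (metis mult.assoc srng_mult)
qed

text \<open>The last conjunct is there for the induction: the join of the first \<open>m\<close> members has to be
  orthogonal to the next one.\<close>

lemma orthogonal_family_typS: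
  fixes f :: "nat \<Rightarrow> 'a::boolean_inverse_semigroup"
  assumes "\<And>i. i < m \<Longrightarrow> f i \<in> Idp" "\<And>i j. i < j \<Longrightarrow> j < m \<Longrightarrow> f i * f j = 0"
  shows "\<exists>e\<in>Idp. typS e = (\<Sum>i<m. typS (f i))
    \<and> (\<forall>h\<in>Idp. (\<forall>i<m. f i * h = 0) \<longrightarrow> e * h = 0)"
  using assms
proof (induction m)
  case 0
  show ?case by (intro bexI[of _ 0]) (simp_all add: typS_eq_0_iff)
next
  case (Suc m)
  then obtain e where e: "e \<in> Idp" "typS e = (\<Sum>i<m. typS (f i))"
      "\<And>h. h \<in> Idp \<Longrightarrow> (\<forall>i<m. f i * h = 0) \<Longrightarrow> e * h = 0"
    by (metis less_Suc_eq)
  have f: "f m \<in> Idp" using Suc.prems by simp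
  have "e * f m = 0" using Suc.prems by (intro e(3)) simp_all
  thus ?case using e f
    by (intro bexI[of _ "isup e (f m)"]) (simp_all add: typS_isup isup_mult_eq_0_iff)
qed

text \<open>If the inequality fails, then some nonzero \<open>g\<close> below \<open>sdom (spow x n)\<close> is disjoint from the
  range of \<open>x\<close>. Its images under the powers of \<open>x\<close> are \<open>n + 1\<close> orthogonal copies of \<open>g\<close>; for the images
  under \<open>x\<^sup>i\<close> and \<open>x\<^sup>j\<close> with \<open>i < j\<close>, cancelling \<open>x\<^sup>i\<close> reduces orthogonality to \<open>g * x = 0\<close>.\<close>

lemma sdom_spow_le_srng_if_index_bound:
  fixes x :: "'a::boolean_inverse_semigroup"
  assumes n: "n > 0" and index: "\<And>e :: 'a. e \<in> Idp \<Longrightarrow> index_bound (typS e) n"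
  shows "srng (spow x n) * sdom (spow x n) = sdom (spow x n)"
proof (rule sdom_spow_le_srng[OF n], rule ccontr)
  assume "srng x * sdom (spow x n) \<noteq> sdom (spow x n)"
  then obtain g where g: "g \<in> Idp" "sdom (spow x n) * g = g" "g * srng x = 0" "g \<noteq> 0"
    using Idp_complement[OF sdom_Idp srng_Idp] by blast
  have gx: "g * x = 0" using g(3) by (metis mult.assoc mult_zero_left srng_mult)
  have gxz: "g * (x * z) = 0" for z using gx by (metis mult.assoc mult_zero_left)
  define s where "s i = ((*) x ^^ i) g" for i
  have s_Suc: "s (Suc i) = x * s i" for i by (simp add: s_def)
  have sg: "s i * g = s i" for i using g by (simp add: s_def Idp_square flip: funpow_mult_assoc)
  \<comment> \<open>The restrictions \<open>s i\<close> of the powers of \<open>x\<close> to \<open>g\<close> have full domain \<open>g\<close>. This is known for \<open>i = n\<close>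
    and descends, since the domains decrease as \<open>i\<close> grows.\<close>
  have sdom_s: "sdom (s (n - k)) = g" if "k \<le> n" for k
    using that
  proof (induction k)
    case 0
    have "sdom (spow x n * g) = g * (sdom (spow x n) * g)"
      using g(1) by (simp add: sdom_def sinv_mult sinv_Idp mult.assoc)
    thus ?case using n g by (simp add: s_def spow_mult Idp_square)
  next
    case (Suc k)
    define t where "t = s (n - Suc k)"
    have st: "s (n - k) = x * t"
      using Suc.prems s_Suc[of "n - Suc k"] by (simp add: t_def Suc_diff_Suc)
    have "sdom (x * t) * sdom t = sdom (x * t)"
      by (simp add: sdom_def sinv_mult mult.assoc sinv')
    hence "g * sdom t = g" using Suc st by simp
    moreover have "sdom t * g = sdom t" using sg by (simp add: t_def sdom_def mult.assoc)
    ultimately show ?case using Idp_commute[OF g(1) sdom_Idp[of t]] by (simp add: t_def)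
  qed
  hence sdom_s: "sdom (s i) = g" if "i \<le> n" for i
    using that by (metis diff_diff_cancel diff_le_self)
  have shift: "sinv (s (Suc i)) * s (Suc j) = sinv (s i) * s j" if "i < n" for i j
  proof -
    \<comment> \<open>As \<open>x * s i\<close> and \<open>s i\<close> have the same domain, the range of \<open>s i\<close> lies in the domain of \<open>x\<close>.\<close>
    have "sdom x * s i = s i"
    proof -
      have "sdom (x * s i) = sdom (s i)"
        using sdom_s[of i] sdom_s[of "Suc i"] that by (simp add: s_Suc)
      hence "s i = s i * sdom (x * s i)" by (simp add: mult_sdom)
      also have "\<dots> = srng (s i) * (sdom x * s i)"
        by (simp add: sdom_def srng_def sinv_mult mult.assoc)
      also have "\<dots> = sdom x * (srng (s i) * s i)" by (rule Idp_left_commute) simp_all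
      finally show ?thesis by (simp add: srng_mult)
    qed
    hence "sinv (s i) * sdom x = sinv (s i)" by (metis sinv_Idp sinv_mult sdom_Idp)
    thus ?thesis by (simp add: s_Suc sinv_mult mult.assoc) (simp add: sdom_def flip: mult.assoc)
  qed
  have "sinv (s i) * s (i + Suc k) = 0" if "i \<le> n" for i k
    using that
  proof (induction i)
    case 0
    show ?case using g gxz by (simp add: s_Suc) (simp add: s_def sinv_Idp)
  qed (simp add: shift)
  hence "srng (s i) * srng (s (i + Suc k)) = 0" if "i \<le> n" for i k
    using that unfolding srng_def by (metis mult.assoc mult_zero_left mult_zero_right)
  hence orth: "srng (s i) * srng (s j) = 0" if "i < j" "j \<le> n" for i j
    using that by (metis add_Suc_right less_iff_Suc_add less_le_trans nat_less_le)
  have D: "typS (srng (s i)) = typS g" if "i \<le> n" for i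
  proof -
    have "greenD (srng (s i)) g"
      using sdom_s[OF that] g
      by (auto simp: greenD_Idp_iff intro!: exI[of _ "sinv (s i)"])
    thus ?thesis by (rule typS_greenD)
  qed
  obtain e where e: "e \<in> Idp" "typS e = (\<Sum>i<n + 1. typS (srng (s i)))"
    using orthogonal_family_typS[of "n + 1" "\<lambda>i. srng (s i)"] orth by auto
  have "typS e = (\<Sum>i<n + 1. typS g)" unfolding e by (rule sum.cong) (simp_all add: D)
  hence "alg_le (\<Sum>i<n + 1. typS g) (typS e)" by (metis add.right_neutral alg_le_def)
  hence "typS g = 0" using index[OF e(1)] by (simp add: index_bound_def)
  thus False using g by (simp add: typS_eq_0_iff)
qed

theorem lemma9p3:
  fixes n :: nat
  assumes "n > 0"
  shows "(\<forall>e \<in> (Idp :: 'a::boolean_inverse_semigroup set). index (typS e) \<le> enat n)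
    \<longleftrightarrow> (\<forall>x :: 'a. sdom (spow x n) = srng (spow x n))"
proof
  assume "\<forall>e \<in> (Idp :: 'a set). index (typS e) \<le> enat n"
  hence index: "\<And>e :: 'a. e \<in> Idp \<Longrightarrow> index_bound (typS e) n" by (simp add: index_le_iff)
  show "\<forall>x :: 'a. sdom (spow x n) = srng (spow x n)"
  proof
    fix x :: 'a
    have "srng (spow x n) * sdom (spow x n) = sdom (spow x n)"
      by (rule sdom_spow_le_srng_if_index_bound[OF assms index])
    moreover have "sdom (spow x n) * srng (spow x n) = srng (spow x n)"
      using sdom_spow_le_srng_if_index_bound[OF assms index, of "sinv x"] assms
      by (simp flip: sinv_spow)
    ultimately show "sdom (spow x n) = srng (spow x n)" by (metis Idp_commute sdom_Idp srng_Idp)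
  qed
next
  assume "\<forall>x :: 'a. sdom (spow x n) = srng (spow x n)"
  thus "\<forall>e \<in> (Idp :: 'a set). index (typS e) \<le> enat n"
    unfolding index_le_iff using index_bound_if_power_domains[OF assms] by blast
qed

end
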